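(* Let $g\geq 1$ be an integer, let $G=\mathrm{Sp}(2g,\mathbb{Z})$, and let $A\in G$ be an element of finite order $m$. Then $m\leq \max\{30, M\}$, where $M=\max\{2(2g)^{g/\alpha},\ (2g)^{(g+1)/\alpha}\}$ and $\alpha=\frac{\log 2}{\log 3}$.
   Context: $\mathrm{Sp}(2g,\mathbb{Z})$ is the group of all $2g\times 2g$ matrices $A$ with integer entries satisfying $A^{\top}JA=J$, where $J=\begin{pmatrix}0_{g} & I_{g}\\ -I_{g} & 0_{g}\end{pmatrix}$. *)

theory Defs
  imports
    Complex_Main
    "HOL-Algebra.Multiplicative_Group"
    "Jordan_Normal_Form.Determinant"
begin

definition symplectic_form :: "nat \<Rightarrow> int mat" where
  "symplectic_form g =
     four_block_mat (0\<^sub>m g g) (1\<^sub>m g) (- 1\<^sub>m g) (0\<^sub>m g g)"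

definition Sp_int :: "nat \<Rightarrow> int mat monoid" where
  "Sp_int g =
     \<lparr>carrier = {A \<in> carrier_mat (2 * g) (2 * g).
        transpose_mat A * symplectic_form g * A = symplectic_form g},
      monoid.mult = (*), one = 1\<^sub>m (2 * g)\<rparr>"

lemma symplectic_form_carrier [simp]:
  "symplectic_form g \<in> carrier_mat (2 * g) (2 * g)"
  unfolding symplectic_form_def mult_2 by simp

lemma symplectic_form_square:
  "symplectic_form g * symplectic_form g = - 1\<^sub>m (2 * g)"
proof -
  have neg0: "- 0\<^sub>m g g = (0\<^sub>m g g :: int mat)"
    by (rule eq_matI) auto
  have "symplectic_form g * symplectic_form g =
      four_block_mat (- 1\<^sub>m g) (0\<^sub>m g g) (0\<^sub>m g g) (- 1\<^sub>m g)"
    unfolding symplectic_form_def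
    by (subst mult_four_block_mat[where ?nr1.0 = g and ?n1.0 = g and ?n2.0 = g
          and ?nr2.0 = g and ?nc1.0 = g and ?nc2.0 = g])
       (simp_all add: neg0)
  also have "\<dots> = - 1\<^sub>m (2 * g)"
    by (rule eq_matI) auto
  finally show ?thesis .
qed

lemma int_mat_mult_left_right_inverse:
  fixes A B :: "int mat"
  assumes A: "A \<in> carrier_mat n n" and B: "B \<in> carrier_mat n n"
    and AB: "A * B = 1\<^sub>m n"
  shows "B * A = 1\<^sub>m n"
proof -
  let ?h = "map_mat (of_int :: int \<Rightarrow> rat)"
  have "?h A * ?h B = ?h (A * B)"
    using A B by (simp add: of_int_hom.mat_hom_mult)
  hence "?h A * ?h B = 1\<^sub>m n"
    by (simp add: AB of_int_hom.mat_hom_one)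
  hence "?h B * ?h A = 1\<^sub>m n"
    using A B by (intro mat_mult_left_right_inverse[of "?h A"]) auto
  hence "?h (B * A) = ?h (1\<^sub>m n)"
    using A B by (simp add: of_int_hom.mat_hom_mult of_int_hom.mat_hom_one)
  thus ?thesis
    by (rule of_int_hom.mat_hom_inj)
qed

lemma symplectic_congruence_mult:
  fixes A B :: "int mat"
  assumes A: "A \<in> carrier_mat n n" and B: "B \<in> carrier_mat n n"
    and J: "J \<in> carrier_mat n n"
  shows "transpose_mat (A * B) * J * (A * B) =
    transpose_mat B * (transpose_mat A * J * A) * B"
proof -
  have At: "transpose_mat A \<in> carrier_mat n n" and Bt: "transpose_mat B \<in> carrier_mat n n"
    using A B by auto
  have "transpose_mat (A * B) * J * (A * B) =
      transpose_mat B * transpose_mat A * J * (A * B)"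
    using A B by (simp add: transpose_mult)
  also have "\<dots> = transpose_mat B * (transpose_mat A * J * A) * B"
    using A B J At Bt by (simp add: assoc_mult_mat[where ?n\<^sub>1 = n and ?n\<^sub>2 = n and ?n\<^sub>3 = n and ?n\<^sub>4 = n])
  finally show ?thesis .
qed

lemma group_Sp_int: "group (Sp_int g)"
proof (rule groupI)
  let ?n = "2 * g" and ?J = "symplectic_form g"
  note assoc = assoc_mult_mat[where ?n\<^sub>1 = "2 * g" and ?n\<^sub>2 = "2 * g" and ?n\<^sub>3 = "2 * g" and ?n\<^sub>4 = "2 * g"]
  show "x \<otimes>\<^bsub>Sp_int g\<^esub> y \<in> carrier (Sp_int g)"
    if "x \<in> carrier (Sp_int g)" "y \<in> carrier (Sp_int g)" for x y
    using that by (auto simp: Sp_int_def symplectic_congruence_mult[where n = ?n])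
  show "\<one>\<^bsub>Sp_int g\<^esub> \<in> carrier (Sp_int g)"
    using left_mult_one_mat[OF symplectic_form_carrier[of g]]
      right_mult_one_mat[OF symplectic_form_carrier[of g]]
    by (simp add: Sp_int_def)
  show "x \<otimes>\<^bsub>Sp_int g\<^esub> y \<otimes>\<^bsub>Sp_int g\<^esub> z = x \<otimes>\<^bsub>Sp_int g\<^esub> (y \<otimes>\<^bsub>Sp_int g\<^esub> z)"
    if "x \<in> carrier (Sp_int g)" "y \<in> carrier (Sp_int g)" "z \<in> carrier (Sp_int g)" for x y z
    using that by (auto simp: Sp_int_def intro!: assoc)
  show "\<one>\<^bsub>Sp_int g\<^esub> \<otimes>\<^bsub>Sp_int g\<^esub> x = x" if "x \<in> carrier (Sp_int g)" for x
    using that by (auto simp: Sp_int_def)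
  show "\<exists>y\<in>carrier (Sp_int g). y \<otimes>\<^bsub>Sp_int g\<^esub> x = \<one>\<^bsub>Sp_int g\<^esub>"
    if x: "x \<in> carrier (Sp_int g)" for x
  proof -
    have X: "x \<in> carrier_mat ?n ?n" and XJ: "transpose_mat x * ?J * x = ?J"
      using x by (auto simp: Sp_int_def)
    have Xt: "transpose_mat x \<in> carrier_mat ?n ?n" using X by auto
    define y where "y = - (?J * (transpose_mat x * ?J))"
    have C: "?J * (transpose_mat x * ?J) \<in> carrier_mat ?n ?n"
      by (intro mult_carrier_mat[of _ _ ?n] Xt symplectic_form_carrier)
    hence Y: "y \<in> carrier_mat ?n ?n" unfolding y_def by simp
    have "(?J * (transpose_mat x * ?J)) * x = ?J * (transpose_mat x * ?J * x)"
      by (intro assoc mult_carrier_mat[of _ _ ?n] X Xt symplectic_form_carrier)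
    hence "(?J * (transpose_mat x * ?J)) * x = - 1\<^sub>m ?n"
      by (simp add: XJ symplectic_form_square)
    moreover have "y * x = - ((?J * (transpose_mat x * ?J)) * x)"
      using C X unfolding y_def by (intro uminus_mult_left_mat) auto
    ultimately have yx: "y * x = 1\<^sub>m ?n"
      by simp
    have xy: "x * y = 1\<^sub>m ?n"
      by (rule int_mat_mult_left_right_inverse[OF Y X yx])
    have "transpose_mat y * ?J * y = transpose_mat y * (transpose_mat x * ?J * x) * y"
      by (simp add: XJ)
    also have "\<dots> = transpose_mat (x * y) * ?J * (x * y)"
      by (rule symplectic_congruence_mult[symmetric, OF X Y symplectic_form_carrier])
    also have "\<dots> = ?J"
      using left_mult_one_mat[OF symplectic_form_carrier[of g]]
        right_mult_one_mat[OF symplectic_form_carrier[of g]]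
      by (simp add: xy)
    finally show ?thesis
      using Y yx by (auto simp: Sp_int_def)
  qed
qed

end

theory Submission
  imports Defs "Jordan_Normal_Form.Char_Poly"
begin

text \<open>
  An integral matrix of finite order \<open>m\<close> and size \<open>n = 2g\<close> satisfies \<open>m \<le> 3^n\<close>.  Two facts give this
  bound.

  First, reduction modulo 3 loses nothing on the powers of \<open>A\<close>: by Minkowski's lemma
  (\<open>torsion_free_cong_one\<close>) the only matrix of finite order congruent to the identity modulo 3 is
  the identity, so the \<open>m\<close> distinct powers of \<open>A\<close> stay distinct modulo 3.  Secondly, by
  Cayley-Hamilton every power of \<open>A\<close> is an integral combination of \<open>A^0, \<dots>, A^(n-1)\<close>
  (\<open>pow_mat_combination_of_low_powers\<close>), and modulo 3 there are only \<open>3^n\<close> choices for the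
  coefficients.  Working inside this \<open>n\<close>-dimensional algebra rather than in the whole group of
  matrices modulo 3 is what keeps the exponent linear in \<open>n\<close>.

  The bound sought is at least as large.  With \<open>1/\<alpha> = log 3 / log 2\<close> one has
  \<open>(2g)^((g+1)/\<alpha>) = 3^((g+1) log\<^sub>2(2g))\<close>, and \<open>(g+1) log\<^sub>2(2g) \<ge> 2g\<close>: equality holds for
  \<open>g = 1\<close>, and \<open>log\<^sub>2(2g) \<ge> 2\<close> for \<open>g \<ge> 2\<close>.
\<close>

section \<open>Powers of a matrix and the Cayley-Hamilton theorem\<close>

lemma pow_mat_add:
  fixes A :: "'a :: semiring_1 mat"
  assumes A: "A \<in> carrier_mat n n"
  shows "A ^\<^sub>m (k + l) = A ^\<^sub>m k * A ^\<^sub>m l"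
proof -
  interpret semiring "ring_mat TYPE('a) n n" by (rule semiring_mat)
  have "A \<in> carrier (ring_mat TYPE('a) n n)" using A by (simp add: ring_mat_simps)
  from nat_pow_mult[OF this, of k l] show ?thesis
    by (simp add: pow_mat_ring_pow[OF A, where b = n] ring_mat_simps)
qed

lemma pow_mat_mult:
  fixes A :: "'a :: semiring_1 mat"
  assumes A: "A \<in> carrier_mat n n"
  shows "(A ^\<^sub>m k) ^\<^sub>m l = A ^\<^sub>m (k * l)"
  by (induction l) (use A in \<open>simp_all add: pow_mat_add[OF A, symmetric] add.commute\<close>)

text \<open>
  Let \<open>B\<close> be the adjugate of \<open>xI - A\<close>, so that \<open>B(xI - A) = \<chi>(x) I\<close>, and let \<open>b k\<close> be the matrix of
  the \<open>k\<close>-th coefficients of \<open>B\<close>.  Comparing coefficients gives \<open>c\<^sub>k I = b (k-1) - b k A\<close>, where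
  \<open>c\<^sub>k\<close> is the \<open>k\<close>-th coefficient of \<open>\<chi>\<close>.
  Multiplied by \<open>A^k\<close> on the right and summed, this telescopes to \<open>- b N A^(N+1)\<close>, which vanishes
  once \<open>N\<close> exceeds the degrees of all entries of \<open>B\<close>.  The identity is stated for entries
  because matrices of a given size form no type over which a sum could be taken.
\<close>
lemma cayley_hamilton_entry:
  fixes A :: "'a :: comm_ring_1 mat"
  assumes A: "A \<in> carrier_mat n n" and i: "i < n" and j: "j < n"
  shows "(\<Sum>k\<le>n. coeff (char_poly A) k * (A ^\<^sub>m k) $$ (i,j)) = 0"
proof -
  define P where "P = char_poly_matrix A"
  define B where "B = adj_mat P"
  define b where "b = (\<lambda>k. map_mat (\<lambda>p. coeff p k) B)"
  have P: "P \<in> carrier_mat n n" using A unfolding P_def by simp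
  have B: "B \<in> carrier_mat n n" and BP: "B * P = char_poly A \<cdot>\<^sub>m 1\<^sub>m n"
    using adj_mat[OF P] unfolding B_def char_poly_def P_def by auto
  have b: "b k \<in> carrier_mat n n" for k using B unfolding b_def by simp
  have P_entry: "P $$ (l,j) = [:- A $$ (l,j), if l = j then 1 else 0:]"
    if "l < n" "j < n" for l j
    using A that unfolding P_def char_poly_matrix_def by auto
  have entry: "(\<Sum>l<n. B $$ (i,l) * P $$ (l,j)) = (if i = j then char_poly A else 0)"
    if "i < n" "j < n" for i j
  proof -
    have "(B * P) $$ (i,j) = (\<Sum>l<n. B $$ (i,l) * P $$ (l,j))"
      using B P that by (auto simp: scalar_prod_def atLeast0LessThan intro!: sum.cong)
    then show ?thesis using that unfolding BP by auto
  qed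
  have summand: "B $$ (i,l) * P $$ (l,j) =
      smult (- A $$ (l,j)) (B $$ (i,l)) + (if l = j then pCons 0 (B $$ (i,j)) else 0)"
    if "l < n" "j < n" for i l j
    using that by (auto simp: P_entry)
  have "(\<Sum>l<n. B $$ (i,l) * P $$ (l,j)) =
      (\<Sum>l<n. smult (- A $$ (l,j)) (B $$ (i,l))) + pCons 0 (B $$ (i,j))"
    if "i < n" "j < n" for i j
    using that by (simp add: summand sum.distrib del: smult_minus_left)
  with entry have E: "(\<Sum>l<n. smult (- A $$ (l,j)) (B $$ (i,l))) + pCons 0 (B $$ (i,j))
      = (if i = j then char_poly A else 0)" if "i < n" "j < n" for i j
    using that by simp
  have bA: "(\<Sum>l<n. A $$ (l,j) * coeff (B $$ (i,l)) k) = (b k * A) $$ (i,j)"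
    if "i < n" "j < n" for i j k
    using B A that unfolding b_def
    by (auto simp: scalar_prod_def atLeast0LessThan mult.commute intro!: sum.cong)
  have rec: "(if i = j then coeff (char_poly A) k else 0) =
      (case k of 0 \<Rightarrow> 0 | Suc k' \<Rightarrow> b k' $$ (i,j)) - (b k * A) $$ (i,j)"
    if "i < n" "j < n" for i j k
    using arg_cong[OF E[OF that], of "\<lambda>p. coeff p k"] that B
    by (auto simp: coeff_sum sum_negf bA b_def coeff_pCons split: nat.splits if_splits)
  have rec0: "coeff (char_poly A) 0 \<cdot>\<^sub>m 1\<^sub>m n = - (b 0 * A)"
  proof (rule eq_matI)
    fix i j assume "i < dim_row (- (b 0 * A))" "j < dim_col (- (b 0 * A))"
    then show "(coeff (char_poly A) 0 \<cdot>\<^sub>m 1\<^sub>m n) $$ (i,j) = (- (b 0 * A)) $$ (i,j)"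
      using rec[of i j 0] A b[of 0] by (cases "i = j") auto
  qed (use A b[of 0] in auto)
  have recS: "coeff (char_poly A) (Suc k) \<cdot>\<^sub>m 1\<^sub>m n = b k - b (Suc k) * A" for k
  proof (rule eq_matI)
    fix i j assume "i < dim_row (b k - b (Suc k) * A)" "j < dim_col (b k - b (Suc k) * A)"
    then show "(coeff (char_poly A) (Suc k) \<cdot>\<^sub>m 1\<^sub>m n) $$ (i,j) = (b k - b (Suc k) * A) $$ (i,j)"
      using rec[of i j "Suc k"] A b[of k] b[of "Suc k"] by (cases "i = j") auto
  qed (use A b[of k] b[of "Suc k"] in auto)
  have tele: "(\<Sum>k\<le>N. coeff (char_poly A) k * (A ^\<^sub>m k) $$ (i,j)) =
      - (b N * A ^\<^sub>m Suc N) $$ (i,j)" for N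
  proof (induction N)
    case 0
    have "coeff (char_poly A) 0 * 1\<^sub>m n $$ (i,j) = (- (b 0 * A)) $$ (i,j)"
      using rec0 i j by (metis index_one_mat(2) index_one_mat(3) index_smult_mat(1))
    then show ?case using A b[of 0] i j by simp
  next
    case (Suc N)
    have pw: "A ^\<^sub>m k \<in> carrier_mat n n" for k using A by simp
    have shift: "A ^\<^sub>m Suc k = A * A ^\<^sub>m k" for k
      using pow_mat_add[OF A, of 1 k] A by simp
    have "coeff (char_poly A) (Suc N) \<cdot>\<^sub>m A ^\<^sub>m Suc N
        = (b N - b (Suc N) * A) * A ^\<^sub>m Suc N"
      unfolding recS[symmetric] using pw[of "Suc N"]
      by (simp del: pow_mat.simps add: mult_smult_assoc_mat[where nr = n and n = n and nc = n]
          left_mult_one_mat[where nr = n and nc = n])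
    also have "\<dots> = b N * A ^\<^sub>m Suc N - b (Suc N) * A ^\<^sub>m Suc (Suc N)"
      unfolding shift[of "Suc N"]
      using b[of N] b[of "Suc N"] A pw[of "Suc N"]
      by (subst minus_mult_distrib_mat[where nr = n and n = n and nc = n])
         (auto simp del: pow_mat.simps
           simp: assoc_mult_mat[where ?n\<^sub>1 = n and ?n\<^sub>2 = n and ?n\<^sub>3 = n and ?n\<^sub>4 = n])
    finally have "(coeff (char_poly A) (Suc N) \<cdot>\<^sub>m A ^\<^sub>m Suc N) $$ (i,j)
        = (b N * A ^\<^sub>m Suc N - b (Suc N) * A ^\<^sub>m Suc (Suc N)) $$ (i,j)" by simp
    then have "coeff (char_poly A) (Suc N) * (A ^\<^sub>m Suc N) $$ (i,j)
        = (b N * A ^\<^sub>m Suc N) $$ (i,j) - (b (Suc N) * A ^\<^sub>m Suc (Suc N)) $$ (i,j)"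
      using A b[of N] b[of "Suc N"] i j
      by (simp del: pow_mat.simps index_mult_mat(1))
    then show ?case using Suc A b[of N] b[of "Suc N"] i j
      by (simp del: pow_mat.simps index_mult_mat(1))
  qed
  \<comment> \<open>\<open>N\<close> need only be at least \<open>n\<close> and above all degrees; a sum is easier to estimate than a maximum.\<close>
  define N where "N = n + (\<Sum>(i,l)\<in>{..<n}\<times>{..<n}. Suc (degree (B $$ (i,l))))"
  have "b N = 0\<^sub>m n n"
  proof (rule eq_matI)
    fix i l assume "i < dim_row (0\<^sub>m n n)" "l < dim_col (0\<^sub>m n n)"
    then have il: "i < n" "l < n" by auto
    have "Suc (degree (B $$ (i,l))) \<le> N"
      using il member_le_sum[of "(i,l)" "{..<n}\<times>{..<n}" "\<lambda>(i,l). Suc (degree (B $$ (i,l)))"]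
      unfolding N_def by auto
    then show "b N $$ (i,l) = 0\<^sub>m n n $$ (i,l)"
      using il B unfolding b_def by (auto intro: coeff_eq_0)
  qed (use b[of N] in auto)
  then have "(\<Sum>k\<le>N. coeff (char_poly A) k * (A ^\<^sub>m k) $$ (i,j)) = 0"
    using tele[of N] A i j by (simp del: pow_mat.simps add: left_mult_zero_mat[where n = n and nc = n])
  moreover have "(\<Sum>k\<le>N. coeff (char_poly A) k * (A ^\<^sub>m k) $$ (i,j)) =
      (\<Sum>k\<le>n. coeff (char_poly A) k * (A ^\<^sub>m k) $$ (i,j))"
    using degree_monic_char_poly[OF A]
    by (intro sum.mono_neutral_right) (auto simp: N_def coeff_eq_0)
  ultimately show ?thesis by simp
qed

text \<open>
  The characteristic polynomial is monic, so \<open>A^n\<close> reduces to lower powers without division; this is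
  why the coefficients stay in the given ring, which is the integers in the application.
\<close>
lemma pow_mat_combination_of_low_powers:
  fixes A :: "'a :: comm_ring_1 mat"
  assumes A: "A \<in> carrier_mat n n"
  shows "\<exists>c. \<forall>i<n. \<forall>j<n. (A ^\<^sub>m N) $$ (i,j) = (\<Sum>k<n. c k * (A ^\<^sub>m k) $$ (i,j))"
proof -
  have low: "\<exists>c. \<forall>i<n. \<forall>j<n. (A ^\<^sub>m M) $$ (i,j) = (\<Sum>k<n. c k * (A ^\<^sub>m k) $$ (i,j))"
    if "M \<le> n" for M
  proof (cases "M = n")
    case True
    have "(A ^\<^sub>m n) $$ (i,j) = (\<Sum>k<n. - coeff (char_poly A) k * (A ^\<^sub>m k) $$ (i,j))"
      if "i < n" "j < n" for i j
    proof -
      have "(\<Sum>k<n. coeff (char_poly A) k * (A ^\<^sub>m k) $$ (i,j)) + 1 * (A ^\<^sub>m n) $$ (i,j) = 0"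
        using cayley_hamilton_entry[OF A that] degree_monic_char_poly[OF A]
        unfolding lessThan_Suc_atMost[symmetric] sum.lessThan_Suc by metis
      then show ?thesis
        unfolding mult_minus_left sum_negf mult_1_left by (metis add_eq_0_iff)
    qed
    then show ?thesis
      unfolding True by (intro exI[of _ "\<lambda>k. - coeff (char_poly A) k"] allI impI)
  next
    case False
    with that have "M < n" by simp
    then have "(A ^\<^sub>m M) $$ (i,j) = (\<Sum>k<n. (if k = M then 1 else 0) * (A ^\<^sub>m k) $$ (i,j))" for i j
      by (simp add: if_distrib[of "\<lambda>x. x * _"] cong: if_cong)
    then show ?thesis by (intro exI[of _ "\<lambda>k. if k = M then 1 else 0"] allI impI)
  qed
  show ?thesis
  proof (induction N)
    case 0
    show ?case using low[of 0] by simp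
  next
    case (Suc N)
    then obtain c where c: "(A ^\<^sub>m N) $$ (i,j) = (\<Sum>k<n. c k * (A ^\<^sub>m k) $$ (i,j))"
      if "i < n" "j < n" for i j by blast
    have "\<forall>k\<in>{..<n}. \<exists>c. \<forall>i<n. \<forall>j<n. (A ^\<^sub>m Suc k) $$ (i,j) = (\<Sum>l<n. c l * (A ^\<^sub>m l) $$ (i,j))"
      by (intro ballI low) auto
    then obtain d where d: "(A ^\<^sub>m Suc k) $$ (i,j) = (\<Sum>l<n. d k l * (A ^\<^sub>m l) $$ (i,j))"
      if "k < n" "i < n" "j < n" for k i j by (metis lessThan_iff)
    have step: "(A ^\<^sub>m Suc k) $$ (i,j) = (\<Sum>l<n. (A ^\<^sub>m k) $$ (i,l) * A $$ (l,j))"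
      if "i < n" "j < n" for i j k
      using A that by (auto simp: scalar_prod_def atLeast0LessThan intro!: sum.cong)
    have "(A ^\<^sub>m Suc N) $$ (i,j) = (\<Sum>l<n. (\<Sum>k<n. c k * d k l) * (A ^\<^sub>m l) $$ (i,j))"
      if ij: "i < n" "j < n" for i j
    proof -
      have "(A ^\<^sub>m Suc N) $$ (i,j) = (\<Sum>l<n. (\<Sum>k<n. c k * (A ^\<^sub>m k) $$ (i,l)) * A $$ (l,j))"
        unfolding step[OF ij] using ij by (intro sum.cong) (simp_all add: c)
      also have "\<dots> = (\<Sum>k<n. c k * (\<Sum>l<n. (A ^\<^sub>m k) $$ (i,l) * A $$ (l,j)))"
        unfolding sum_distrib_left sum_distrib_right mult.assoc by (rule sum.swap)
      also have "\<dots> = (\<Sum>k<n. c k * (\<Sum>l<n. d k l * (A ^\<^sub>m l) $$ (i,j)))"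
        using ij by (intro sum.cong) (simp_all add: step[symmetric] d del: pow_mat.simps)
      also have "\<dots> = (\<Sum>l<n. (\<Sum>k<n. c k * d k l) * (A ^\<^sub>m l) $$ (i,j))"
        unfolding sum_distrib_left sum_distrib_right mult.assoc by (rule sum.swap)
      finally show ?thesis .
    qed
    then show ?case by (intro exI[of _ "\<lambda>l. \<Sum>k<n. c k * d k l"] allI impI)
  qed
qed

section \<open>Torsion in the congruence subgroup of level 3\<close>

text \<open>
  Iterating the equation makes every entry of \<open>D\<close> divisible by every power of 3.
\<close>
lemma mat_eq_0_if_eq_3_mult:
  fixes D E :: "int mat"
  assumes D: "D \<in> carrier_mat n n" and E: "E \<in> carrier_mat n n" and eq: "D = 3 \<cdot>\<^sub>m (D * E)"
  shows "D = 0\<^sub>m n n"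
proof (rule eq_matI)
  have div: "\<forall>i<n. \<forall>j<n. 3 ^ k dvd D $$ (i,j)" for k
  proof (induction k)
    case (Suc k)
    have "D $$ (i,j) = 3 * (\<Sum>l<n. D $$ (i,l) * E $$ (l,j))" if "i < n" "j < n" for i j
      using D E that by (subst eq) (auto simp: scalar_prod_def atLeast0LessThan intro!: sum.cong)
    with Suc show ?case by (auto intro!: mult_dvd_mono dvd_sum)
  qed simp
  fix i j assume "i < dim_row (0\<^sub>m n n)" "j < dim_col (0\<^sub>m n n)"
  then have ij: "i < n" "j < n" by auto
  let ?x = "D $$ (i,j)"
  have "?x = 0"
  proof (rule ccontr)
    assume "?x \<noteq> 0"
    moreover have "3 ^ nat \<bar>?x\<bar> dvd ?x" using div ij by blast
    ultimately have "3 ^ nat \<bar>?x\<bar> \<le> \<bar>?x\<bar>" using dvd_imp_le_int[of ?x "3 ^ nat \<bar>?x\<bar>"] by simp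
    moreover have "nat \<bar>?x\<bar> < 3 ^ nat \<bar>?x\<bar>" by (rule power_gt_expt) simp
    then have "\<bar>?x\<bar> < 3 ^ nat \<bar>?x\<bar>"
      by (metis int_nat_eq abs_ge_zero of_nat_less_iff of_nat_power of_nat_numeral)
    ultimately show False by simp
  qed
  then show "?x = 0\<^sub>m n n $$ (i,j)" using ij by simp
qed (use D in auto)

text \<open>
  The binomial expansion of \<open>(1 + 3F)^m\<close> with all terms of degree at least 2 in \<open>3F\<close> collected in
  \<open>G\<close>.  Pulling out the factor \<open>F\<close> on the left makes \<open>(1 + 3F)^m = 1\<close> an equation \<open>m F = - 3 F G\<close>, to which the previous
  lemma applies if 3 does not divide \<open>m\<close>.
\<close>
lemma pow_mat_one_plus_3:
  fixes F :: "int mat"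
  assumes F: "F \<in> carrier_mat n n"
  shows "\<exists>G\<in>carrier_mat n n. (1\<^sub>m n + 3 \<cdot>\<^sub>m F) ^\<^sub>m m =
    1\<^sub>m n + 3 \<cdot>\<^sub>m (F * (int m \<cdot>\<^sub>m 1\<^sub>m n + 3 \<cdot>\<^sub>m G))"
proof (induction m)
  case 0
  have "1\<^sub>m n = 1\<^sub>m n + 3 \<cdot>\<^sub>m (F * (0 \<cdot>\<^sub>m 1\<^sub>m n + 3 \<cdot>\<^sub>m 0\<^sub>m n n))"
    using F by (intro eq_matI) (auto simp: scalar_prod_def)
  then show ?case using F by (intro bexI[of _ "0\<^sub>m n n"]) auto
next
  case (Suc m)
  then obtain G where G: "G \<in> carrier_mat n n" and
    IH: "(1\<^sub>m n + 3 \<cdot>\<^sub>m F) ^\<^sub>m m = 1\<^sub>m n + 3 \<cdot>\<^sub>m (F * (int m \<cdot>\<^sub>m 1\<^sub>m n + 3 \<cdot>\<^sub>m G))"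
    by blast
  \<comment> \<open>\<open>9 F G'\<close> is what \<open>(1 + 3F(m + 3G))(1 + 3F)\<close> contains besides \<open>1 + 3(m+1)F\<close>.\<close>
  define G' where "G' = G + int m \<cdot>\<^sub>m F + 3 \<cdot>\<^sub>m (G * F)"
  have FF: "F * F \<in> carrier_mat n n" "F * G \<in> carrier_mat n n" "G * F \<in> carrier_mat n n"
    "F * (G * F) \<in> carrier_mat n n" using F G by auto
  note distrib = add_mult_distrib_mat[where nr = n and n = n and nc = n]
    mult_add_distrib_mat[where nr = n and n = n and nc = n]
    mult_smult_distrib[where nr = n and n = n and nc = n]
    mult_smult_assoc_mat[where nr = n and n = n and nc = n]
    assoc_mult_mat[where ?n\<^sub>1 = n and ?n\<^sub>2 = n and ?n\<^sub>3 = n and ?n\<^sub>4 = n]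
  have "(1\<^sub>m n + 3 \<cdot>\<^sub>m F) ^\<^sub>m Suc m =
      (1\<^sub>m n + 3 \<cdot>\<^sub>m (F * (int m \<cdot>\<^sub>m 1\<^sub>m n + 3 \<cdot>\<^sub>m G))) * (1\<^sub>m n + 3 \<cdot>\<^sub>m F)"
    by (simp add: IH)
  also have "\<dots> = 1\<^sub>m n + 3 \<cdot>\<^sub>m (F * (int (Suc m) \<cdot>\<^sub>m 1\<^sub>m n + 3 \<cdot>\<^sub>m G'))"
    unfolding G'_def using F G FF
    by (simp add: distrib) (rule eq_matI; simp add: algebra_simps del: index_mult_mat(1))
  finally show ?case using F G FF unfolding G'_def by (intro bexI[rotated]) auto
qed

text \<open>
  Since \<open>m^2 = 3t + 1\<close>, multiplying \<open>m F = - 3 F G\<close> by \<open>m\<close> gives \<open>F = 3 F (- m G - t)\<close>.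
\<close>
lemma torsion_free_cong_one_coprime_3:
  fixes F :: "int mat"
  assumes F: "F \<in> carrier_mat n n" and m: "\<not> 3 dvd m"
    and eq: "(1\<^sub>m n + 3 \<cdot>\<^sub>m F) ^\<^sub>m m = 1\<^sub>m n"
  shows "F = 0\<^sub>m n n"
proof -
  obtain G where G: "G \<in> carrier_mat n n" and
    "(1\<^sub>m n + 3 \<cdot>\<^sub>m F) ^\<^sub>m m = 1\<^sub>m n + 3 \<cdot>\<^sub>m (F * (int m \<cdot>\<^sub>m 1\<^sub>m n + 3 \<cdot>\<^sub>m G))"
    using pow_mat_one_plus_3[OF F] by blast
  with eq have one: "1\<^sub>m n = 1\<^sub>m n + 3 \<cdot>\<^sub>m (F * (int m \<cdot>\<^sub>m 1\<^sub>m n + 3 \<cdot>\<^sub>m G))" by simp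
  have FG: "F * G \<in> carrier_mat n n" using F G by simp
  note distrib = mult_add_distrib_mat[where nr = n and n = n and nc = n]
    mult_smult_distrib[where nr = n and n = n and nc = n]
  have entry: "int m * F $$ (i,j) + 3 * (F * G) $$ (i,j) = 0" if "i < n" "j < n" for i j
    using arg_cong[OF one, of "\<lambda>X. X $$ (i,j)"] F G FG that
    by (simp add: distrib del: index_mult_mat(1))
  have "\<exists>t. int m * int m = 3 * t + 1"
  proof -
    have "m mod 3 = 1 \<or> m mod 3 = 2" using m by presburger
    then have "m * m mod 3 = 1" by (auto simp: mod_mult_eq[of m 3 m, symmetric])
    then have "int m * int m mod 3 = 1" by (metis of_nat_1 of_nat_mod of_nat_mult of_nat_numeral)
    then show ?thesis by (metis mult_div_mod_eq)
  qed
  then obtain t where t: "int m * int m = 3 * t + 1" by blast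
  define E where "E = (- int m) \<cdot>\<^sub>m G + (- t) \<cdot>\<^sub>m 1\<^sub>m n"
  have E: "E \<in> carrier_mat n n" using G unfolding E_def by simp
  have "F = 3 \<cdot>\<^sub>m (F * E)"
  proof (rule eq_matI)
    fix i j assume "i < dim_row (3 \<cdot>\<^sub>m (F * E))" "j < dim_col (3 \<cdot>\<^sub>m (F * E))"
    then have ij: "i < n" "j < n" using F E by auto
    have "(int m * int m) * F $$ (i,j) = - 3 * int m * (F * G) $$ (i,j)"
      using arg_cong[OF entry[OF ij], of "\<lambda>x. int m * x"] by (simp add: algebra_simps)
    then show "F $$ (i,j) = (3 \<cdot>\<^sub>m (F * E)) $$ (i,j)"
      using F G FG ij unfolding t E_def
      by (simp add: distrib algebra_simps del: index_mult_mat(1))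
  qed (use F E in auto)
  then show ?thesis by (rule mat_eq_0_if_eq_3_mult[OF F E])
qed

text \<open>
  For exponent 3 the coefficient of \<open>F\<close> is itself divisible by 3, but so are the binomial
  coefficients of the next term, and one factor 3 survives: \<open>(1 + 3F)^3 - 1 = 9 (F + 3 F^2 + 3 F^3)\<close>, whence \<open>F = - 3 F (F + F^2)\<close>.
  Modulo 2 this fails, as \<open>-1\<close> shows.
\<close>
lemma torsion_free_cong_one_3:
  fixes F :: "int mat"
  assumes F: "F \<in> carrier_mat n n" and eq: "(1\<^sub>m n + 3 \<cdot>\<^sub>m F) ^\<^sub>m 3 = 1\<^sub>m n"
  shows "F = 0\<^sub>m n n"
proof -
  define E where "E = (- 1) \<cdot>\<^sub>m (F + F * F)"
  have FF: "F * F \<in> carrier_mat n n" "F * (F * F) \<in> carrier_mat n n" using F by auto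
  have E: "E \<in> carrier_mat n n" using F unfolding E_def by simp
  note distrib = add_mult_distrib_mat[where nr = n and n = n and nc = n]
    mult_add_distrib_mat[where nr = n and n = n and nc = n]
    mult_smult_distrib[where nr = n and n = n and nc = n]
    mult_smult_assoc_mat[where nr = n and n = n and nc = n]
    assoc_mult_mat[where ?n\<^sub>1 = n and ?n\<^sub>2 = n and ?n\<^sub>3 = n and ?n\<^sub>4 = n]
  have "F = 3 \<cdot>\<^sub>m (F * E)"
  proof (rule eq_matI)
    fix i j assume "i < dim_row (3 \<cdot>\<^sub>m (F * E))" "j < dim_col (3 \<cdot>\<^sub>m (F * E))"
    then have ij: "i < n" "j < n" using F E by auto
    have "((1\<^sub>m n + 3 \<cdot>\<^sub>m F) * (1\<^sub>m n + 3 \<cdot>\<^sub>m F) * (1\<^sub>m n + 3 \<cdot>\<^sub>m F)) $$ (i,j) = 1\<^sub>m n $$ (i,j)"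
      using F eq by (simp add: numeral_3_eq_3)
    then show "F $$ (i,j) = (3 \<cdot>\<^sub>m (F * E)) $$ (i,j)"
      using F FF ij unfolding E_def
      by (simp add: distrib algebra_simps del: index_mult_mat(1))
  qed (use F E in auto)
  then show ?thesis by (rule mat_eq_0_if_eq_3_mult[OF F E])
qed

text \<open>
  Minkowski's lemma at the prime 3.  A factor 3 of the exponent is removed by applying the case of
  exponent 3 to \<open>(1 + 3F)^(m/3)\<close>, which is again congruent to 1 modulo 3.
\<close>
lemma torsion_free_cong_one:
  fixes F :: "int mat"
  assumes F: "F \<in> carrier_mat n n" and "m > 0"
    and "(1\<^sub>m n + 3 \<cdot>\<^sub>m F) ^\<^sub>m m = 1\<^sub>m n"
  shows "F = 0\<^sub>m n n"
  using assms(2,3)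
proof (induction m rule: less_induct)
  case (less m)
  let ?B = "1\<^sub>m n + 3 \<cdot>\<^sub>m F"
  have B: "?B \<in> carrier_mat n n" using F by simp
  show ?case
  proof (cases "3 dvd m")
    case False
    then show ?thesis using torsion_free_cong_one_coprime_3[OF F] less.prems by blast
  next
    case True
    then obtain k where k: "m = k * 3" by (metis dvd_def mult.commute)
    obtain G where G: "G \<in> carrier_mat n n" and
      Bk: "?B ^\<^sub>m k = 1\<^sub>m n + 3 \<cdot>\<^sub>m (F * (int k \<cdot>\<^sub>m 1\<^sub>m n + 3 \<cdot>\<^sub>m G))"
      using pow_mat_one_plus_3[OF F] by blast
    define F' where "F' = F * (int k \<cdot>\<^sub>m 1\<^sub>m n + 3 \<cdot>\<^sub>m G)"
    have F': "F' \<in> carrier_mat n n" using F G unfolding F'_def by simp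
    have "(?B ^\<^sub>m k) ^\<^sub>m 3 = 1\<^sub>m n"
      using less.prems unfolding pow_mat_mult[OF B] k by simp
    then have "F' = 0\<^sub>m n n"
      unfolding Bk F'_def[symmetric] by (rule torsion_free_cong_one_3[OF F'])
    then have "?B ^\<^sub>m k = 1\<^sub>m n" unfolding Bk F'_def[symmetric] by simp
    then show ?thesis using less.IH[of k] less.prems k by simp
  qed
qed

section \<open>Counting powers modulo 3\<close>

text \<open>
  Send \<open>N < m\<close> to the coefficients, modulo 3, that express \<open>A^N\<close> by low powers.  If \<open>N < N'\<close> have
  the same image, then \<open>A^N\<close> and \<open>A^N'\<close> are congruent modulo 3; multiplying by \<open>A^(m-N)\<close> makes
  \<open>A^(N'-N)\<close> congruent to 1, hence equal to 1 by Minkowski's lemma, against the minimality of \<open>m\<close>.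
\<close>
lemma pow_mat_order_le:
  fixes A :: "int mat"
  assumes A: "A \<in> carrier_mat n n" and m: "A ^\<^sub>m m = 1\<^sub>m n"
    and min: "\<And>d. 0 < d \<Longrightarrow> d < m \<Longrightarrow> A ^\<^sub>m d \<noteq> 1\<^sub>m n"
  shows "m \<le> 3 ^ n"
proof -
  have pw: "A ^\<^sub>m k \<in> carrier_mat n n" for k using A by simp
  obtain c where c: "\<And>N i j. i < n \<Longrightarrow> j < n \<Longrightarrow>
      (A ^\<^sub>m N) $$ (i,j) = (\<Sum>k<n. c N k * (A ^\<^sub>m k) $$ (i,j))"
    using pow_mat_combination_of_low_powers[OF A] by metis
  define f where "f = (\<lambda>N. restrict (\<lambda>k. c N k mod 3) {..<n})"
  have "inj_on f {..<m}"
  proof (rule linorder_inj_onI')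
    fix N N' assume NN': "N \<in> {..<m}" "N' \<in> {..<m}" "N < N'"
    show "f N \<noteq> f N'"
    proof
      assume "f N = f N'"
      then have "c N k mod 3 = c N' k mod 3" if "k < n" for k
        using that unfolding f_def by (metis lessThan_iff restrict_apply')
      then have dvd: "3 dvd c N' k - c N k" if "k < n" for k
        using that by (metis mod_eq_dvd_iff)
      have "3 dvd (A ^\<^sub>m N') $$ (i,j) - (A ^\<^sub>m N) $$ (i,j)" if "i < n" "j < n" for i j
        unfolding c[OF that, of N] c[OF that, of N'] sum_subtractf[symmetric] left_diff_distrib[symmetric]
        using dvd by (auto intro!: dvd_sum)
      then have div: "3 * (((A ^\<^sub>m N') $$ (i,j) - (A ^\<^sub>m N) $$ (i,j)) div 3)
          = (A ^\<^sub>m N') $$ (i,j) - (A ^\<^sub>m N) $$ (i,j)" if "i < n" "j < n" for i j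
        using that by simp
      define E where "E = mat n n (\<lambda>(i,j). ((A ^\<^sub>m N') $$ (i,j) - (A ^\<^sub>m N) $$ (i,j)) div 3)"
      have E: "E \<in> carrier_mat n n" unfolding E_def by simp
      have eq: "A ^\<^sub>m N' = A ^\<^sub>m N + 3 \<cdot>\<^sub>m E"
        using pw[of N] pw[of N'] by (intro eq_matI) (auto simp: E_def div)
      define d where "d = N' - N"
      have d: "0 < d" "d < m" using NN' unfolding d_def by auto
      define F where "F = E * A ^\<^sub>m (m - N)"
      have F: "F \<in> carrier_mat n n" using E pw unfolding F_def by simp
      have "A ^\<^sub>m d = A ^\<^sub>m (d + m)" unfolding pow_mat_add[OF A] m
        using right_mult_one_mat[OF pw[of d]] by simp
      also have "\<dots> = A ^\<^sub>m (N' + (m - N))" using NN' unfolding d_def by simp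
      also have "\<dots> = A ^\<^sub>m N' * A ^\<^sub>m (m - N)" by (rule pow_mat_add[OF A])
      also have "\<dots> = A ^\<^sub>m N * A ^\<^sub>m (m - N) + 3 \<cdot>\<^sub>m F"
        unfolding eq F_def using E pw[of N] pw[of "m - N"]
        by (simp add: add_mult_distrib_mat[where nr = n and n = n and nc = n]
            mult_smult_assoc_mat[where nr = n and n = n and nc = n])
      also have "A ^\<^sub>m N * A ^\<^sub>m (m - N) = 1\<^sub>m n"
        using NN' m by (simp add: pow_mat_add[OF A, symmetric])
      finally have Ad: "A ^\<^sub>m d = 1\<^sub>m n + 3 \<cdot>\<^sub>m F" .
      have "(A ^\<^sub>m d) ^\<^sub>m m = 1\<^sub>m n"
      proof -
        have "(1\<^sub>m n :: int mat) ^\<^sub>m d = 1\<^sub>m n" by (induction d) auto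
        then show ?thesis
          using pow_mat_mult[OF A, of m d] m by (simp add: pow_mat_mult[OF A] mult.commute)
      qed
      then have "F = 0\<^sub>m n n"
        unfolding Ad using d by (intro torsion_free_cong_one[OF F, of m]) auto
      then have "A ^\<^sub>m d = 1\<^sub>m n" unfolding Ad by simp
      with min d show False by blast
    qed
  qed
  moreover have "f ` {..<m} \<subseteq> {..<n} \<rightarrow>\<^sub>E {0..<3}" unfolding f_def
    by (auto simp: image_subset_iff restrict_PiE_iff)
  moreover have "finite ({..<n} \<rightarrow>\<^sub>E {0..<3::int})" by (intro finite_PiE) auto
  ultimately have "card {..<m} \<le> card ({..<n} \<rightarrow>\<^sub>E {0..<3::int})" by (rule card_inj_on_le)
  then show ?thesis by (simp add: card_PiE)
qed

section \<open>Comparison with the stated bound\<close>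

lemma three_power_le_powr:
  assumes "g \<ge> (1::nat)"
  shows "3 ^ (2 * g) \<le> (2 * real g) powr ((real g + 1) / (ln 2 / ln 3))"
proof -
  have "2 * real g * ln 2 \<le> (real g + 1) * ln (2 * real g)"
  proof (cases "g = 1")
    case False
    with assms have "g \<ge> 2" by simp
    have "2 * real g * ln 2 \<le> (real g + 1) * (2 * ln 2)" by (simp add: algebra_simps)
    also have "2 * ln 2 = ln (4::real)" using ln_realpow[of 2 2] by simp
    also have "(real g + 1) * ln 4 \<le> (real g + 1) * ln (2 * real g)"
      using \<open>g \<ge> 2\<close> by (intro mult_left_mono) auto
    finally show ?thesis .
  qed simp
  then have "2 * real g \<le> (real g + 1) / ln 2 * ln (2 * real g)"
    by (simp add: field_simps)
  then have "2 * real g * ln 3 \<le> (real g + 1) / ln 2 * ln (2 * real g) * ln 3"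
    by (intro mult_right_mono) auto
  then have "3 powr (2 * real g) \<le> (2 * real g) powr ((real g + 1) / (ln 2 / ln 3))"
    using assms by (simp add: powr_def mult_ac)
  moreover have "3 powr (2 * real g) = (3::real) ^ (2 * g)"
    using powr_realpow[of 3 "2 * g"] by simp
  ultimately show ?thesis by simp
qed

theorem theorem1p2:
  fixes g m :: nat and A :: "int mat" and \<alpha> M :: real
  assumes "g \<ge> 1"
    and "A \<in> carrier (Sp_int g)"
    and "group.ord (Sp_int g) A = m"
    and "m \<noteq> 0"
    and "\<alpha> = ln 2 / ln 3"
    and "M = max (2 * (2 * real g) powr (real g / \<alpha>))
                 ((2 * real g) powr ((real g + 1) / \<alpha>))"
  shows "real m \<le> max 30 M"
proof -
  interpret group "Sp_int g" by (rule group_Sp_int)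
  have A: "A \<in> carrier_mat (2 * g) (2 * g)" using assms(2) by (simp add: Sp_int_def)
  have pow: "A [^]\<^bsub>Sp_int g\<^esub> (k::nat) = A ^\<^sub>m k" for k
    using A by (induction k) (auto simp: Sp_int_def)
  have one: "\<one>\<^bsub>Sp_int g\<^esub> = 1\<^sub>m (2 * g)" by (simp add: Sp_int_def)
  have "m \<le> 3 ^ (2 * g)"
  proof (rule pow_mat_order_le[OF A])
    show "A ^\<^sub>m m = 1\<^sub>m (2 * g)"
      using pow_ord_eq_1[OF assms(2)] assms(3) by (simp add: pow one)
    show "A ^\<^sub>m d \<noteq> 1\<^sub>m (2 * g)" if "0 < d" "d < m" for d
      using that pow_eq_id[OF assms(2), of d] assms(3) by (auto simp: pow one dest: dvd_imp_le)
  qed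
  then have "real m \<le> 3 ^ (2 * g)"
    by (metis of_nat_le_iff of_nat_power of_nat_numeral)
  also have "\<dots> \<le> M"
    using three_power_le_powr[OF assms(1)] unfolding assms(5,6) by simp
  finally show ?thesis by simp
qed

end
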